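(* Let $\mathcal{E} = \langle \mathfrak{V}, \mathcal{T}, \Theta\rangle$ be a locally countable evolution system with the transition amalgamation property. Then there exists an evolution in $\mathcal{E}$ with the absorption property (for transitions), and it is unique up to isomorphism: if $\vec u$ and $\vec v$ are two evolutions with the absorption property, then their colimits $\lim \vec u$ and $\lim \vec v$ are isomorphic in $\mathfrak{V}$.
   Context: An evolution system is a structure $\mathcal{E} = \langle \mathfrak{V}, \mathcal{T}, \Theta\rangle$ where $\mathfrak{V}$ is a (locally small) category, $\Theta$ is a fixed $\mathfrak{V}$-object (the origin), and $\mathcal{T}$ is a class of $\mathfrak{V}$-arrows (transitions) such that all identities are in $\mathcal{T}$, and $h\circ t \in \mathcal{T}$ whenever $t \in \mathcal{T}$ and $h$ is an isomorphism of $\mathfrak{V}$ with $h \circ t$ defined (so all isomorphisms are transitions). For an object $X$, $\mathcal{T}(X)$ is the set of transitions with domain $X$. An evolution is a functor $\vec u$ from $\omega$ (as a poset category) to $\mathfrak{V}$, with objects $U_n$ and arrows $u_n^m\colon U_n \to U_m$ ($n \le m$), such that $U_0=\Theta$ and each $u_n^{n+1}$ is a transition. Standing assumption: every evolution has a colimit in $\mathfrak{V}$, denoted $\lim\vec u$. A path is a finite composition of transitions. An object $X$ is finite if there is a path from $\Theta$ to $X$. Transition amalgamation property: for every two transitions $f,g$ with $\operatorname{dom}(f)=\operatorname{dom}(g)$ a finite object, there exist transitions $f',g'$ with $f'\circ f = g'\circ g$. Locally countable: for every finite object $X$ there is a countable set $\mathcal{F}(X)\subseteq \mathcal{T}(X)$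 such that for every $f\in\mathcal{T}(X)$ there is an isomorphism $h$ with $h\circ f\in\mathcal{F}(X)$. An evolution $\vec u$ has the absorption property (for transitions) if for every $n\in\omega$ and every transition $t\colon U_n\to Y$ there are $m\ge n$ and a path $g\colon Y\to U_m$ such that $g\circ t = u_n^m$. *)

theory Defs
  imports Main "HOL-Library.Countable_Set"
begin

section \<open>Categories\<close>

text \<open>
  Categories are carrier-based: \<open>Obj\<close> and \<open>Arr\<close> are sets over arbitrary types of objects and
  arrows, and all operations are unspecified outside the carriers.  Hom-collections are therefore
  always sets (local smallness).
\<close>

record ('o, 'a) cat_struct =
  Obj :: "'o set"
  Arr :: "'a set"
  Dom :: "'a \<Rightarrow> 'o"
  Cod :: "'a \<Rightarrow> 'o"
  Ident :: "'o \<Rightarrow> 'a"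
  Comp :: "'a \<Rightarrow> 'a \<Rightarrow> 'a"  (infixl "\<cdot>\<index>" 70)

definition Hom :: "('o, 'a) cat_struct \<Rightarrow> 'o \<Rightarrow> 'o \<Rightarrow> 'a set" where
  "Hom V X Y = {f \<in> Arr V. Dom V f = X \<and> Cod V f = Y}"

locale category =
  fixes V :: "('o, 'a) cat_struct" (structure)
  assumes Dom_in_Obj: "f \<in> Arr V \<Longrightarrow> Dom V f \<in> Obj V"
    and Cod_in_Obj: "f \<in> Arr V \<Longrightarrow> Cod V f \<in> Obj V"
    and Ident_in_Hom: "X \<in> Obj V \<Longrightarrow> Ident V X \<in> Hom V X X"
    and Comp_in_Hom: "\<lbrakk>f \<in> Hom V X Y; g \<in> Hom V Y Z\<rbrakk> \<Longrightarrow> g \<cdot> f \<in> Hom V X Z"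
    and Comp_Ident_right: "f \<in> Hom V X Y \<Longrightarrow> f \<cdot> Ident V X = f"
    and Comp_Ident_left: "f \<in> Hom V X Y \<Longrightarrow> Ident V Y \<cdot> f = f"
    and Comp_assoc:
      "\<lbrakk>f \<in> Hom V W X; g \<in> Hom V X Y; h \<in> Hom V Y Z\<rbrakk> \<Longrightarrow> (h \<cdot> g) \<cdot> f = h \<cdot> (g \<cdot> f)"

definition is_iso :: "('o, 'a) cat_struct \<Rightarrow> 'a \<Rightarrow> bool" where
  "is_iso V h \<longleftrightarrow> h \<in> Arr V \<and>
     (\<exists>k \<in> Hom V (Cod V h) (Dom V h).
        k \<cdot>\<^bsub>V\<^esub> h = Ident V (Dom V h) \<and> h \<cdot>\<^bsub>V\<^esub> k = Ident V (Cod V h))"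

definition isomorphic_objects :: "('o, 'a) cat_struct \<Rightarrow> 'o \<Rightarrow> 'o \<Rightarrow> bool" where
  "isomorphic_objects V X Y \<longleftrightarrow> (\<exists>h \<in> Hom V X Y. is_iso V h)"

section \<open>Functors from \<open>\<omega>\<close> and their colimits\<close>

text \<open>
  A functor from the poset category \<open>\<omega>\<close> is given by its objects \<open>U n\<close> and its arrows
  \<open>u n m\<close> from \<open>U n\<close> to \<open>U m\<close>; the values \<open>u n m\<close> with \<open>m < n\<close> are irrelevant.
\<close>

definition omega_functor ::
    "('o, 'a) cat_struct \<Rightarrow> (nat \<Rightarrow> 'o) \<Rightarrow> (nat \<Rightarrow> nat \<Rightarrow> 'a) \<Rightarrow> bool" where
  "omega_functor V U u \<longleftrightarrow>
     (\<forall>n. U n \<in> Obj V) \<and>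
     (\<forall>n m. n \<le> m \<longrightarrow> u n m \<in> Hom V (U n) (U m)) \<and>
     (\<forall>n. u n n = Ident V (U n)) \<and>
     (\<forall>n m k. n \<le> m \<longrightarrow> m \<le> k \<longrightarrow> u n k = u m k \<cdot>\<^bsub>V\<^esub> u n m)"

definition is_cocone ::
    "('o, 'a) cat_struct \<Rightarrow> (nat \<Rightarrow> 'o) \<Rightarrow> (nat \<Rightarrow> nat \<Rightarrow> 'a) \<Rightarrow> 'o \<Rightarrow> (nat \<Rightarrow> 'a) \<Rightarrow> bool" where
  "is_cocone V U u L c \<longleftrightarrow>
     L \<in> Obj V \<and>
     (\<forall>n. c n \<in> Hom V (U n) L) \<and>
     (\<forall>n m. n \<le> m \<longrightarrow> c m \<cdot>\<^bsub>V\<^esub> u n m = c n)"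

definition is_colimit ::
    "('o, 'a) cat_struct \<Rightarrow> (nat \<Rightarrow> 'o) \<Rightarrow> (nat \<Rightarrow> nat \<Rightarrow> 'a) \<Rightarrow> 'o \<Rightarrow> (nat \<Rightarrow> 'a) \<Rightarrow> bool" where
  "is_colimit V U u L c \<longleftrightarrow>
     is_cocone V U u L c \<and>
     (\<forall>M d. is_cocone V U u M d \<longrightarrow>
        (\<exists>!k. k \<in> Hom V L M \<and> (\<forall>n. k \<cdot>\<^bsub>V\<^esub> c n = d n)))"

section \<open>Evolution systems\<close>

definition evolution ::
    "('o, 'a) cat_struct \<Rightarrow> 'a set \<Rightarrow> 'o \<Rightarrow> (nat \<Rightarrow> 'o) \<Rightarrow> (nat \<Rightarrow> nat \<Rightarrow> 'a) \<Rightarrow> bool" where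
  "evolution V T \<Theta> U u \<longleftrightarrow>
     omega_functor V U u \<and> U 0 = \<Theta> \<and> (\<forall>n. u n (Suc n) \<in> T)"

text \<open>The existence of colimits of evolutions is a standing assumption, hence part of the locale.\<close>

locale evolution_system = category V
  for V :: "('o, 'a) cat_struct" (structure) +
  fixes T :: "'a set" and \<Theta> :: 'o
  assumes origin_in_Obj: "\<Theta> \<in> Obj V"
    and transitions_subset: "T \<subseteq> Arr V"
    and Ident_in_transitions: "X \<in> Obj V \<Longrightarrow> Ident V X \<in> T"
    and iso_Comp_in_transitions: "\<lbrakk>t \<in> T; is_iso V h; Dom V h = Cod V t\<rbrakk> \<Longrightarrow> h \<cdot> t \<in> T"
    and evolution_has_colimit: "evolution V T \<Theta> U u \<Longrightarrow> \<exists>L c. is_colimit V U u L c"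

definition transitions_from :: "('o, 'a) cat_struct \<Rightarrow> 'a set \<Rightarrow> 'o \<Rightarrow> 'a set" where
  "transitions_from V T X = {t \<in> T. Dom V t = X}"

text \<open>The empty composition needs no clause of its own, as identities are transitions.\<close>

inductive_set paths :: "('o, 'a) cat_struct \<Rightarrow> 'a set \<Rightarrow> 'a set"
  for V :: "('o, 'a) cat_struct" and T :: "'a set" where
  transition: "t \<in> T \<Longrightarrow> t \<in> paths V T"
| compose: "\<lbrakk>p \<in> paths V T; t \<in> T; Dom V t = Cod V p\<rbrakk> \<Longrightarrow> t \<cdot>\<^bsub>V\<^esub> p \<in> paths V T"

definition finite_object :: "('o, 'a) cat_struct \<Rightarrow> 'a set \<Rightarrow> 'o \<Rightarrow> 'o \<Rightarrow> bool" where
  "finite_object V T \<Theta> X \<longleftrightarrow> (\<exists>p \<in> paths V T. p \<in> Hom V \<Theta> X)"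

definition transition_amalgamation :: "('o, 'a) cat_struct \<Rightarrow> 'a set \<Rightarrow> 'o \<Rightarrow> bool" where
  "transition_amalgamation V T \<Theta> \<longleftrightarrow>
     (\<forall>f \<in> T. \<forall>g \<in> T. Dom V f = Dom V g \<longrightarrow> finite_object V T \<Theta> (Dom V f) \<longrightarrow>
        (\<exists>f' \<in> T. \<exists>g' \<in> T. Dom V f' = Cod V f \<and> Dom V g' = Cod V g \<and>
           f' \<cdot>\<^bsub>V\<^esub> f = g' \<cdot>\<^bsub>V\<^esub> g))"

definition locally_countable :: "('o, 'a) cat_struct \<Rightarrow> 'a set \<Rightarrow> 'o \<Rightarrow> bool" where
  "locally_countable V T \<Theta> \<longleftrightarrow>
     (\<forall>X. finite_object V T \<Theta> X \<longrightarrow>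
        (\<exists>F \<subseteq> transitions_from V T X. countable F \<and>
           (\<forall>f \<in> transitions_from V T X. \<exists>h. is_iso V h \<and> Dom V h = Cod V f \<and> h \<cdot>\<^bsub>V\<^esub> f \<in> F)))"

definition absorption_property ::
    "('o, 'a) cat_struct \<Rightarrow> 'a set \<Rightarrow> (nat \<Rightarrow> 'o) \<Rightarrow> (nat \<Rightarrow> nat \<Rightarrow> 'a) \<Rightarrow> bool" where
  "absorption_property V T U u \<longleftrightarrow>
     (\<forall>n. \<forall>t \<in> transitions_from V T (U n).
        \<exists>m \<ge> n. \<exists>g \<in> paths V T. g \<in> Hom V (Cod V t) (U m) \<and> g \<cdot>\<^bsub>V\<^esub> t = u n m)"

end

theory Submission
  imports Defs
begin

text \<open>
  Amalgamation extends from two transitions to a transition and a path, so an evolution can be built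
  step by step in which every transition from a listed countable family is eventually absorbed;
  local countability makes the list exhaustive up to isomorphism.  For uniqueness, the absorption
  property extends to paths, and a back-and-forth argument interleaves the two evolutions into one
  commuting zigzag, whose two colimits are the given ones.
\<close>

section \<open>Colimits over omega and their restriction to subsequences\<close>

context category
begin

lemma Hom_Arr: "f \<in> Arr V \<Longrightarrow> f \<in> Hom V (Dom V f) (Cod V f)"
  by (simp add: Hom_def)

lemma Hom_Dom: "f \<in> Hom V X Y \<Longrightarrow> Dom V f = X"
  and Hom_Cod: "f \<in> Hom V X Y \<Longrightarrow> Cod V f = Y"
  by (simp_all add: Hom_def)

lemma Hom_Dom_in_Obj: "f \<in> Hom V X Y \<Longrightarrow> X \<in> Obj V"
  and Hom_Cod_in_Obj: "f \<in> Hom V X Y \<Longrightarrow> Y \<in> Obj V"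
  using Dom_in_Obj Cod_in_Obj by (auto simp: Hom_def)

lemma isomorphic_objectsI:
  assumes "f \<in> Hom V X Y" "g \<in> Hom V Y X" "g \<cdot> f = Ident V X" "f \<cdot> g = Ident V Y"
  shows "isomorphic_objects V X Y"
  using assms unfolding isomorphic_objects_def is_iso_def
  by (intro bexI[of _ f]) (auto simp: Hom_def)

context
  fixes U u L c
  assumes omega: "omega_functor V U u" and colim: "is_colimit V U u L c"
begin

lemma functor_Hom: "n \<le> m \<Longrightarrow> u n m \<in> Hom V (U n) (U m)"
  and functor_Ident: "u n n = Ident V (U n)"
  and functor_Comp: "n \<le> m \<Longrightarrow> m \<le> k \<Longrightarrow> u n k = u m k \<cdot> u n m"
  using omega unfolding omega_functor_def by blast+

lemma colimit_Hom: "c n \<in> Hom V (U n) L"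
  and colimit_Comp: "n \<le> m \<Longrightarrow> c m \<cdot> u n m = c n"
  using colim unfolding is_colimit_def is_cocone_def by blast+

text \<open>A cofinal subsequence of the legs is jointly epic: since \<open>n \<le> N n\<close>,
  each leg \<open>c n\<close> factors through \<open>c (N n)\<close>, so agreement on the
  subsequence spreads to all legs.\<close>

lemma colimit_arrow_eqI:
  assumes N: "\<And>k. k \<le> N k"
    and k: "k \<in> Hom V L M" and l: "l \<in> Hom V L M"
    and eq: "\<And>i. k \<cdot> c (N i) = l \<cdot> c (N i)"
  shows "k = l"
proof -
  have eq': "k \<cdot> c n = l \<cdot> c n" for n
  proof -
    have "k \<cdot> c n = k \<cdot> (c (N n) \<cdot> u n (N n))"
      using colimit_Comp N by simp
    also have "\<dots> = (k \<cdot> c (N n)) \<cdot> u n (N n)"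
      using Comp_assoc[OF functor_Hom colimit_Hom k] N by simp
    also have "\<dots> = (l \<cdot> c (N n)) \<cdot> u n (N n)"
      using eq by simp
    also have "\<dots> = l \<cdot> (c (N n) \<cdot> u n (N n))"
      using Comp_assoc[OF functor_Hom colimit_Hom l] N by simp
    also have "\<dots> = l \<cdot> c n"
      using colimit_Comp N by simp
    finally show ?thesis .
  qed
  \<comment> \<open>Both \<open>k\<close> and \<open>l\<close> mediate to this cocone, so uniqueness
    in the universal property identifies them.\<close>
  have "is_cocone V U u M (\<lambda>n. l \<cdot> c n)"
    unfolding is_cocone_def
  proof (intro conjI allI impI)
    show "M \<in> Obj V" using l Hom_Cod_in_Obj by blast
    show "l \<cdot> c n \<in> Hom V (U n) M" for n
      using Comp_in_Hom colimit_Hom l by blast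
    show "l \<cdot> c m \<cdot> u n m = l \<cdot> c n" if "n \<le> m" for n m
      using Comp_assoc[OF functor_Hom[OF that] colimit_Hom l] colimit_Comp[OF that] by simp
  qed
  then have "\<exists>!k. k \<in> Hom V L M \<and> (\<forall>n. k \<cdot> c n = l \<cdot> c n)"
    using colim unfolding is_colimit_def by blast
  then show ?thesis using k l eq' by blast
qed

text \<open>A compatible family on a cofinal subsequence extends to a cocone on the whole sequence
  by precomposing with connecting arrows. Compatibility of consecutive members suffices, as it
  iterates.\<close>

lemma colimit_arrow_from_subsequence:
  assumes N: "strict_mono N"
    and e: "\<And>k. e k \<in> Hom V (U (N k)) M"
    and e_Suc: "\<And>k. e (Suc k) \<cdot> u (N k) (N (Suc k)) = e k"
  obtains h where "h \<in> Hom V L M" "\<And>k. h \<cdot> c (N k) = e k"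
proof -
  have le: "N i \<le> N j" if "i \<le> j" for i j
    using N that by (simp add: strict_mono_less_eq)
  have ge: "k \<le> N k" for k
    using N by (rule strict_mono_imp_increasing)
  have e_le: "e j \<cdot> u (N i) (N j) = e i" if "i \<le> j" for i j
    using that
  proof (induction j rule: dec_induct)
    case base
    then show ?case
      using functor_Ident Comp_Ident_right[OF e] by simp
  next
    case (step j)
    have "e (Suc j) \<cdot> u (N i) (N (Suc j)) = e (Suc j) \<cdot> (u (N j) (N (Suc j)) \<cdot> u (N i) (N j))"
      using functor_Comp[of "N i" "N j" "N (Suc j)"] le step by simp
    also have "\<dots> = e (Suc j) \<cdot> u (N j) (N (Suc j)) \<cdot> u (N i) (N j)"
      using Comp_assoc[OF functor_Hom functor_Hom e] le step by simp
    finally show ?case using e_Suc step by simp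
  qed
  \<comment> \<open>As \<open>n \<le> N n\<close>, the number \<open>n\<close> itself can serve as
    the index in the subsequence; \<open>d_eq\<close> shows that any other index \<open>i\<close>
    with \<open>n \<le> N i\<close> gives the same arrow.\<close>
  define d where "d n = e n \<cdot> u n (N n)" for n
  have d_Hom: "d n \<in> Hom V (U n) M" for n
    unfolding d_def using Comp_in_Hom[OF functor_Hom e] ge by blast
  have d_eq: "e j \<cdot> u n (N j) = e i \<cdot> u n (N i)" if "i \<le> j" "n \<le> N i" for i j n
  proof -
    have "e j \<cdot> u n (N j) = e j \<cdot> (u (N i) (N j) \<cdot> u n (N i))"
      using functor_Comp[of n "N i" "N j"] le that by simp
    also have "\<dots> = e j \<cdot> u (N i) (N j) \<cdot> u n (N i)"
      using Comp_assoc[OF functor_Hom functor_Hom e] le that by simp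
    finally show ?thesis using e_le that by simp
  qed
  have "is_cocone V U u M d"
    unfolding is_cocone_def
  proof (intro conjI allI impI)
    show "M \<in> Obj V" using e Hom_Cod_in_Obj by blast
    show "d n \<in> Hom V (U n) M" for n by (rule d_Hom)
    show "d m \<cdot> u n m = d n" if "n \<le> m" for n m
    proof -
      have "d m \<cdot> u n m = e m \<cdot> (u m (N m) \<cdot> u n m)"
        unfolding d_def using Comp_assoc[OF functor_Hom functor_Hom e] that ge by blast
      also have "\<dots> = e m \<cdot> u n (N m)"
        using functor_Comp[OF that ge] by simp
      finally show ?thesis
        using d_eq[OF that] ge unfolding d_def by simp
    qed
  qed
  then obtain h where h: "h \<in> Hom V L M" "\<And>n. h \<cdot> c n = d n"
    using colim unfolding is_colimit_def by blast
  \<comment> \<open>By definition \<open>d (N k)\<close> passes through \<open>U (N (N k))\<close>;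
    independence of the index allows \<open>e k\<close> and an identity arrow instead.\<close>
  moreover have "d (N k) = e k" for k
    using d_eq[of k "N k" "N k"] ge e_le[of k k] unfolding d_def by simp
  ultimately show thesis using that by simp
qed

end

text \<open>Following \<open>f\<close> into \<open>M\<close> induces an arrow \<open>a\<close> from
  \<open>L\<close> to \<open>M\<close>, and following \<open>g\<close> into \<open>L\<close> induces
  \<open>b\<close> back. On a leg of either subsequence a round trip is one turn of the zigzag, that
  is, a connecting arrow, which the cocone absorbs; hence both composites are identities.\<close>

lemma zigzag_colimits_isomorphic:
  assumes U: "omega_functor V U u" "is_colimit V U u L c"
    and W: "omega_functor V W w" "is_colimit V W w M d"
    and N: "strict_mono N" and K: "strict_mono K"
    and f: "\<And>k. f k \<in> Hom V (U (N k)) (W (K k))"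
    and g: "\<And>k. g k \<in> Hom V (W (K k)) (U (N (Suc k)))"
    and gf: "\<And>k. g k \<cdot> f k = u (N k) (N (Suc k))"
    and fg: "\<And>k. f (Suc k) \<cdot> g k = w (K k) (K (Suc k))"
  shows "isomorphic_objects V L M"
proof -
  note cH = colimit_Hom[OF U] and dH = colimit_Hom[OF W]
  have leN: "N k \<le> N (Suc k)" and leK: "K k \<le> K (Suc k)" for k
    using N K by (simp_all add: strict_mono_less_eq)
  \<comment> \<open>Splitting the connecting arrow of \<open>u\<close> as
    \<open>g k \<cdot> f k\<close> and regrouping produces a connecting arrow of \<open>w\<close>,
    which vanishes into the cocone \<open>d\<close>.\<close>
  have "d (K (Suc k)) \<cdot> f (Suc k) \<cdot> u (N k) (N (Suc k)) = d (K k) \<cdot> f k" for k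
  proof -
    have "d (K (Suc k)) \<cdot> f (Suc k) \<cdot> u (N k) (N (Suc k))
        = d (K (Suc k)) \<cdot> (f (Suc k) \<cdot> (g k \<cdot> f k))"
      unfolding gf by (rule Comp_assoc[OF functor_Hom[OF U leN] f dH])
    also have "\<dots> = d (K (Suc k)) \<cdot> (w (K k) (K (Suc k)) \<cdot> f k)"
      using Comp_assoc[OF f g f] fg by metis
    also have "\<dots> = d (K k) \<cdot> f k"
      using Comp_assoc[OF f functor_Hom[OF W leK] dH] colimit_Comp[OF W leK] by metis
    finally show ?thesis .
  qed
  then obtain a where a: "a \<in> Hom V L M" "\<And>k. a \<cdot> c (N k) = d (K k) \<cdot> f k"
    using colimit_arrow_from_subsequence[OF U N, of "\<lambda>k. d (K k) \<cdot> f k" M] Comp_in_Hom[OF f dH]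
    by blast
  have "c (N (Suc (Suc k))) \<cdot> g (Suc k) \<cdot> w (K k) (K (Suc k)) = c (N (Suc k)) \<cdot> g k" for k
  proof -
    have "c (N (Suc (Suc k))) \<cdot> g (Suc k) \<cdot> w (K k) (K (Suc k))
        = c (N (Suc (Suc k))) \<cdot> (g (Suc k) \<cdot> (f (Suc k) \<cdot> g k))"
      unfolding fg by (rule Comp_assoc[OF functor_Hom[OF W leK] g cH])
    also have "\<dots> = c (N (Suc (Suc k))) \<cdot> (u (N (Suc k)) (N (Suc (Suc k))) \<cdot> g k)"
      using Comp_assoc[OF g f g] gf by metis
    also have "\<dots> = c (N (Suc k)) \<cdot> g k"
      using Comp_assoc[OF g functor_Hom[OF U leN] cH] colimit_Comp[OF U leN] by metis
    finally show ?thesis .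
  qed
  then obtain b where b: "b \<in> Hom V M L" "\<And>k. b \<cdot> d (K k) = c (N (Suc k)) \<cdot> g k"
    using colimit_arrow_from_subsequence[OF W K, of "\<lambda>k. c (N (Suc k)) \<cdot> g k" L] Comp_in_Hom[OF g cH]
    by blast
  have IL: "Ident V L \<in> Hom V L L" and IM: "Ident V M \<in> Hom V M M"
    using a Hom_Dom_in_Obj Hom_Cod_in_Obj Ident_in_Hom by blast+
  have "b \<cdot> a = Ident V L"
  proof (rule colimit_arrow_eqI[OF U strict_mono_imp_increasing[OF N] Comp_in_Hom[OF a(1) b(1)] IL])
    fix k
    have "b \<cdot> a \<cdot> c (N k) = b \<cdot> (d (K k) \<cdot> f k)"
      using Comp_assoc[OF cH a(1) b(1)] a(2) by simp
    also have "\<dots> = c (N (Suc k)) \<cdot> g k \<cdot> f k"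
      using Comp_assoc[OF f dH b(1)] b(2) by simp
    also have "\<dots> = c (N k)"
      using Comp_assoc[OF f g cH] gf colimit_Comp[OF U leN] by simp
    finally show "b \<cdot> a \<cdot> c (N k) = Ident V L \<cdot> c (N k)"
      using Comp_Ident_left[OF cH] by simp
  qed
  moreover have "a \<cdot> b = Ident V M"
  proof (rule colimit_arrow_eqI[OF W strict_mono_imp_increasing[OF K] Comp_in_Hom[OF b(1) a(1)] IM])
    fix k
    have "a \<cdot> b \<cdot> d (K k) = a \<cdot> (c (N (Suc k)) \<cdot> g k)"
      using Comp_assoc[OF dH b(1) a(1)] b(2) by simp
    also have "\<dots> = d (K (Suc k)) \<cdot> f (Suc k) \<cdot> g k"
      using Comp_assoc[OF g cH a(1)] a(2) by simp
    also have "\<dots> = d (K k)"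
      using Comp_assoc[OF g f dH] fg colimit_Comp[OF W leK] by simp
    finally show "a \<cdot> b \<cdot> d (K k) = Ident V M \<cdot> d (K k)"
      using Comp_Ident_left[OF dH] by simp
  qed
  ultimately show ?thesis
    using isomorphic_objectsI a(1) b(1) by blast
qed

end

section \<open>Paths, finite objects and evolutions\<close>

context evolution_system
begin

lemma transition_Hom: "t \<in> T \<Longrightarrow> t \<in> Hom V (Dom V t) (Cod V t)"
  using transitions_subset Hom_Arr by blast

text \<open>Composing \<open>h\<close> with the identity of its domain, which is a transition, gives
  \<open>h\<close> back.\<close>

lemma iso_transition:
  assumes "is_iso V h"
  shows "h \<in> T"
proof -
  have "h \<in> Hom V (Dom V h) (Cod V h)"
    using assms Hom_Arr by (auto simp: is_iso_def)
  then have "h \<cdot> Ident V (Dom V h) = h" and I: "Ident V (Dom V h) \<in> Hom V (Dom V h) (Dom V h)"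
      and "Ident V (Dom V h) \<in> T"
    by (auto intro: Comp_Ident_right Ident_in_Hom Ident_in_transitions dest: Hom_Dom_in_Obj)
  then show ?thesis
    using iso_Comp_in_transitions[of "Ident V (Dom V h)" h] assms Hom_Cod[OF I] by simp
qed

lemma path_Hom: "p \<in> paths V T \<Longrightarrow> p \<in> Hom V (Dom V p) (Cod V p)"
proof (induction rule: paths.induct)
  case (compose p t)
  then have "t \<cdot> p \<in> Hom V (Dom V p) (Cod V t)"
    using Comp_in_Hom transition_Hom by metis
  then show ?case by (simp add: Hom_def)
qed (rule transition_Hom)

text \<open>Paths grow by postcomposing a transition, so the induction runs over the outer path
  \<open>q\<close> and reassociates; its codomain \<open>Z\<close> varies along the way.\<close>

lemma path_Comp:
  "\<lbrakk>q \<in> paths V T; p \<in> paths V T; p \<in> Hom V X Y; q \<in> Hom V Y Z\<rbrakk> \<Longrightarrow> q \<cdot> p \<in> paths V T"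
proof (induction arbitrary: Z rule: paths.induct)
  case (transition t)
  then show ?case by (simp add: Hom_def paths.compose)
next
  case (compose q t)
  have q: "q \<in> Hom V (Dom V q) (Cod V q)" and t: "t \<in> Hom V (Cod V q) (Cod V t)"
    using path_Hom transition_Hom compose by metis+
  have "Dom V q = Y"
    using Hom_Dom[OF Comp_in_Hom[OF q t]] Hom_Dom[OF compose.prems(3)] by simp
  then have q': "q \<in> Hom V Y (Cod V q)" using q by simp
  have "t \<cdot> q \<cdot> p = t \<cdot> (q \<cdot> p)"
    using Comp_assoc[OF compose.prems(2) q' t] .
  moreover have "q \<cdot> p \<in> paths V T"
    using compose q' by blast
  moreover have "Cod V (q \<cdot> p) = Cod V q"
    using Hom_Cod[OF Comp_in_Hom[OF compose.prems(2) q']] .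
  ultimately show ?case
    using compose by (simp add: paths.compose)
qed

lemma finite_object_path:
  "\<lbrakk>finite_object V T \<Theta> X; p \<in> paths V T; p \<in> Hom V X Y\<rbrakk> \<Longrightarrow> finite_object V T \<Theta> Y"
  unfolding finite_object_def by (meson path_Comp Comp_in_Hom)

lemma finite_object_origin: "finite_object V T \<Theta> \<Theta>"
  unfolding finite_object_def
  using Ident_in_Hom[OF origin_in_Obj] paths.transition[OF Ident_in_transitions[OF origin_in_Obj]]
  by (rule bexI)

lemma finite_object_in_Obj: "finite_object V T \<Theta> X \<Longrightarrow> X \<in> Obj V"
  unfolding finite_object_def using Hom_Cod_in_Obj by blast

lemma evolution_origin: "evolution V T \<Theta> U u \<Longrightarrow> U 0 = \<Theta>"
  and evolution_Hom: "\<lbrakk>evolution V T \<Theta> U u; n \<le> m\<rbrakk> \<Longrightarrow> u n m \<in> Hom V (U n) (U m)"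
  and evolution_Ident: "evolution V T \<Theta> U u \<Longrightarrow> u n n = Ident V (U n)"
  and evolution_Comp:
    "\<lbrakk>evolution V T \<Theta> U u; n \<le> m; m \<le> k\<rbrakk> \<Longrightarrow> u n k = u m k \<cdot> u n m"
  and evolution_transition: "evolution V T \<Theta> U u \<Longrightarrow> u n (Suc n) \<in> T"
  unfolding evolution_def omega_functor_def by blast+

lemma evolution_path:
  assumes ev: "evolution V T \<Theta> U u" and "n \<le> m"
  shows "u n m \<in> paths V T"
  using assms(2)
proof (induction m rule: dec_induct)
  case base
  have "U n \<in> Obj V" using Hom_Dom_in_Obj[OF evolution_Hom[OF ev order_refl]] .
  then show ?case
    using paths.transition[OF Ident_in_transitions] evolution_Ident[OF ev] by simp
next
  case (step m)
  have "u n (Suc m) = u m (Suc m) \<cdot> u n m"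
    using evolution_Comp[OF ev step(1), of "Suc m"] by simp
  moreover have "Dom V (u m (Suc m)) = U m"
    using Hom_Dom[OF evolution_Hom[OF ev, of m "Suc m"]] by simp
  moreover have "Cod V (u n m) = U m"
    using Hom_Cod[OF evolution_Hom[OF ev step(1)]] .
  ultimately show ?case
    using paths.compose[OF step.IH evolution_transition[OF ev]] by simp
qed

lemma evolution_finite:
  assumes "evolution V T \<Theta> U u"
  shows "finite_object V T \<Theta> (U n)"
  using finite_object_path[OF finite_object_origin evolution_path[OF assms le0]]
    evolution_Hom[OF assms le0] evolution_origin[OF assms] by metis

section \<open>Amalgamation and absorption along paths\<close>

text \<open>The transition \<open>f\<close> is pushed along \<open>p\<close> one square at a time.
  Its image is a transition after every square, so the next amalgamation applies, while the opposite
  sides accumulate to a path. Finiteness of \<open>X\<close> passes to every object along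
  \<open>p\<close>, as amalgamation demands.\<close>

lemma amalgamate_path:
  assumes TA: "transition_amalgamation V T \<Theta>"
    and "finite_object V T \<Theta> X" and f: "f \<in> T" "f \<in> Hom V X Y"
    and "p \<in> paths V T" "p \<in> Hom V X Z"
  shows "\<exists>A. \<exists>f' \<in> T. \<exists>p' \<in> paths V T. f' \<in> Hom V Z A \<and> p' \<in> Hom V Y A \<and> f' \<cdot> p = p' \<cdot> f"
  using assms(5,6)
proof (induction arbitrary: Z rule: paths.induct)
  case (transition t)
  have "Dom V f = Dom V t" "finite_object V T \<Theta> (Dom V f)"
    using f transition assms(2) by (simp_all add: Hom_def)
  then obtain f' t' where *: "f' \<in> T" "t' \<in> T" "Dom V f' = Cod V t" "Dom V t' = Cod V f"
      "f' \<cdot> t = t' \<cdot> f"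
    using TA f transition unfolding transition_amalgamation_def by metis
  then have f': "f' \<in> Hom V Z (Cod V f')" and t': "t' \<in> Hom V Y (Cod V t')"
    using transition_Hom transition f Hom_Cod by metis+
  \<comment> \<open>Amalgamation does not mention a common codomain; it follows because the two
    composites are the same arrow.\<close>
  moreover have "Cod V t' = Cod V f'"
    using * Hom_Cod[OF Comp_in_Hom[OF transition(2) f']] Hom_Cod[OF Comp_in_Hom[OF f(2) t']] by simp
  ultimately show ?case using * paths.transition by metis
next
  case (compose p t)
  define P where "P = Cod V p"
  have p0: "p \<in> Hom V (Dom V p) P" and t0: "t \<in> Hom V P (Cod V t)"
    using path_Hom transition_Hom compose P_def by metis+
  have "Dom V p = X" "Cod V t = Z"
    using compose.prems Comp_in_Hom[OF p0 t0] by (auto simp: Hom_def)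
  then have p: "p \<in> Hom V X P" and t: "t \<in> Hom V P Z"
    using p0 t0 by auto
  obtain A f' p' where *: "f' \<in> T" "p' \<in> paths V T" "f' \<in> Hom V P A" "p' \<in> Hom V Y A" "f' \<cdot> p = p' \<cdot> f"
    using compose.IH p by blast
  have "finite_object V T \<Theta> P"
    using finite_object_path assms p compose by blast
  \<comment> \<open>The new square shares the side \<open>f'\<close> with the square over
    \<open>p\<close>, so the two paste together.\<close>
  then obtain f'' t' where **: "f'' \<in> T" "t' \<in> T" "Dom V f'' = Cod V t" "Dom V t' = Cod V f'"
      "f'' \<cdot> t = t' \<cdot> f'"
    using TA *(1) compose(2) Hom_Dom[OF *(3)] Hom_Dom[OF t]
    unfolding transition_amalgamation_def by metis
  then have f'': "f'' \<in> Hom V Z (Cod V f'')" and t': "t' \<in> Hom V A (Cod V t')"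
    using transition_Hom *(3) t Hom_Cod by metis+
  have cod: "Cod V t' = Cod V f''"
    using ** Hom_Cod[OF Comp_in_Hom[OF t f'']] Hom_Cod[OF Comp_in_Hom[OF *(3) t']] by simp
  have "f'' \<cdot> (t \<cdot> p) = t' \<cdot> p' \<cdot> f"
    using Comp_assoc[OF p t f''] Comp_assoc[OF p *(3) t'] Comp_assoc[OF f(2) *(4) t'] * ** by simp
  moreover have "t' \<cdot> p' \<in> paths V T"
    using paths.compose * ** Hom_Cod by metis
  ultimately show ?case
    using Comp_in_Hom[OF *(4) t'] f'' ** cod by metis
qed

text \<open>Once \<open>p\<close> is absorbed by \<open>g\<close>, the last transition
  \<open>t\<close> still starts at \<open>P\<close>, not at an object of the evolution. Amalgamating
  it with \<open>g\<close> turns it into a transition \<open>t'\<close> out of \<open>U m\<close>,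
  to which the absorption property applies.\<close>

lemma absorption_path:
  assumes TA: "transition_amalgamation V T \<Theta>"
    and ev: "evolution V T \<Theta> U u" and ab: "absorption_property V T U u"
    and "p \<in> paths V T" "p \<in> Hom V (U n) Y"
  shows "\<exists>m \<ge> n. \<exists>g \<in> paths V T. g \<in> Hom V Y (U m) \<and> g \<cdot> p = u n m"
  using assms(4,5)
proof (induction arbitrary: Y rule: paths.induct)
  case (transition t)
  then have "t \<in> transitions_from V T (U n)" "Cod V t = Y"
    by (auto simp: transitions_from_def Hom_def)
  then show ?case
    using ab unfolding absorption_property_def by blast
next
  case (compose p t)
  define P where "P = Cod V p"
  have p0: "p \<in> Hom V (Dom V p) P" and t0: "t \<in> Hom V P (Cod V t)"
    using path_Hom transition_Hom compose P_def by metis+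
  have "Dom V p = U n" "Cod V t = Y"
    using compose.prems Comp_in_Hom[OF p0 t0] by (auto simp: Hom_def)
  then have p: "p \<in> Hom V (U n) P" and t: "t \<in> Hom V P Y"
    using p0 t0 by auto
  obtain m g where g: "n \<le> m" "g \<in> paths V T" "g \<in> Hom V P (U m)" "g \<cdot> p = u n m"
    using compose.IH p by blast
  have "finite_object V T \<Theta> P"
    using finite_object_path[OF evolution_finite[OF ev] compose(1) p] .
  then obtain A t' g' where *: "t' \<in> T" "g' \<in> paths V T" "t' \<in> Hom V (U m) A" "g' \<in> Hom V Y A"
      "t' \<cdot> g = g' \<cdot> t"
    using amalgamate_path[OF TA _ compose(2) t g(2,3)] by blast
  then obtain k h where h: "m \<le> k" "h \<in> paths V T" "h \<in> Hom V A (U k)" "h \<cdot> t' = u m k"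
    using ab Hom_Dom[OF *(3)] Hom_Cod[OF *(3)]
    unfolding absorption_property_def transitions_from_def by fast
  have "h \<cdot> g' \<cdot> (t \<cdot> p) = h \<cdot> t' \<cdot> (g \<cdot> p)"
    using Comp_assoc[OF Comp_in_Hom[OF p t] *(4) h(3)] Comp_assoc[OF p t *(4)]
      Comp_assoc[OF p g(3) *(3)] Comp_assoc[OF Comp_in_Hom[OF p g(3)] *(3) h(3)] *(5) by simp
  also have "\<dots> = u n k"
    using h g evolution_Comp[OF ev g(1) h(1)] by simp
  finally have "h \<cdot> g' \<cdot> (t \<cdot> p) = u n k" .
  moreover have "h \<cdot> g' \<in> paths V T" "h \<cdot> g' \<in> Hom V Y (U k)" "n \<le> k"
    using path_Comp[OF h(2) *(2) *(4) h(3)] Comp_in_Hom[OF *(4) h(3)] g(1) h(1) by simp_all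
  ultimately show ?case by blast
qed

text \<open>Appending one more step of the evolution makes the index grow strictly, so that the
  back-and-forth visits cofinal subsequences.\<close>

lemma absorption_path_Suc:
  assumes "transition_amalgamation V T \<Theta>"
    and ev: "evolution V T \<Theta> U u" and "absorption_property V T U u"
    and p: "p \<in> paths V T" "p \<in> Hom V (U n) Y"
  obtains m g where "m > n" "g \<in> paths V T" "g \<in> Hom V Y (U m)" "g \<cdot> p = u n m"
proof -
  obtain m g where g: "n \<le> m" "g \<in> paths V T" "g \<in> Hom V Y (U m)" "g \<cdot> p = u n m"
    using absorption_path assms by blast
  have u: "u m (Suc m) \<in> Hom V (U m) (U (Suc m))" "u m (Suc m) \<in> T"
      "u n (Suc m) = u m (Suc m) \<cdot> u n m"
    using evolution_Hom[OF ev, of m "Suc m"] evolution_transition[OF ev]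
      evolution_Comp[OF ev g(1), of "Suc m"] by simp_all
  show thesis
  proof
    show "Suc m > n" using g by simp
    show "u m (Suc m) \<cdot> g \<in> paths V T"
      using paths.compose g u Hom_Dom Hom_Cod by metis
    show "u m (Suc m) \<cdot> g \<in> Hom V Y (U (Suc m))"
      using Comp_in_Hom g u by blast
    show "u m (Suc m) \<cdot> g \<cdot> p = u n (Suc m)"
      using Comp_assoc[OF p(2) g(3) u(1)] g u by simp
  qed
qed

section \<open>Uniqueness by back-and-forth\<close>

lemma absorbing_colimits_isomorphic:
  assumes TA: "transition_amalgamation V T \<Theta>"
    and U: "evolution V T \<Theta> U u" "absorption_property V T U u" "is_colimit V U u L c"
    and W: "evolution V T \<Theta> W w" "absorption_property V T W w" "is_colimit V W w M d"
  shows "isomorphic_objects V L M"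
proof -
  \<comment> \<open>A state is a rung \<open>f\<close> from \<open>U n\<close> to
    \<open>W m\<close>. It has to be a path, for it is absorbed in the next round; the return arrow
    \<open>g\<close> is absorbed within its own round, so \<open>Q\<close> keeps only its type and
    the two commuting triangles.\<close>
  define P where "P s \<longleftrightarrow> (case s of (n, m, f) \<Rightarrow> f \<in> paths V T \<and> f \<in> Hom V (U n) (W m))" for s
  define Q where "Q s s' \<longleftrightarrow> (case s of (n, m, f) \<Rightarrow> case s' of (n', m', f') \<Rightarrow>
      n < n' \<and> m < m' \<and> (\<exists>g \<in> Hom V (W m) (U n'). g \<cdot> f = u n n' \<and> f' \<cdot> g = w m m'))" for s s'
  have "\<exists>s. \<forall>k. P (s k) \<and> Q (s k) (s (Suc k))"
  proof (rule dependent_nat_choice)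
    \<comment> \<open>Both evolutions start at the origin, which supplies the first rung.\<close>
    have "P (0, 0, Ident V \<Theta>)"
      unfolding P_def
      using evolution_origin[OF U(1)] evolution_origin[OF W(1)] Ident_in_Hom[OF origin_in_Obj]
        paths.transition[OF Ident_in_transitions[OF origin_in_Obj]]
      by simp
    then show "\<exists>s. P s" ..
  next
    fix s :: "nat \<times> nat \<times> 'a"
    assume "P s"
    then obtain n m f where s: "s = (n, m, f)" and f: "f \<in> paths V T" "f \<in> Hom V (U n) (W m)"
      unfolding P_def by (cases s) auto
    obtain n' g where g: "n' > n" "g \<in> paths V T" "g \<in> Hom V (W m) (U n')" "g \<cdot> f = u n n'"
      using absorption_path_Suc[OF TA U(1,2) f] by blast
    obtain m' f' where "m' > m" "f' \<in> paths V T" "f' \<in> Hom V (U n') (W m')" "f' \<cdot> g = w m m'"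
      using absorption_path_Suc[OF TA W(1,2) g(2,3)] by blast
    then have "P (n', m', f') \<and> Q s (n', m', f')"
      unfolding P_def Q_def s using g by auto
    then show "\<exists>s'. P s' \<and> Q s s'" by blast
  qed
  then obtain s where s: "\<And>k. P (s k)" "\<And>k. Q (s k) (s (Suc k))" by blast
  define N where "N k = fst (s k)" for k
  define K where "K k = fst (snd (s k))" for k
  define f where "f k = snd (snd (s k))" for k
  have f: "f k \<in> Hom V (U (N k)) (W (K k))" for k
    using s(1)[of k] unfolding P_def N_def K_def f_def by (auto split: prod.splits)
  have Q: "N k < N (Suc k) \<and> K k < K (Suc k) \<and> (\<exists>g \<in> Hom V (W (K k)) (U (N (Suc k))).
      g \<cdot> f k = u (N k) (N (Suc k)) \<and> f (Suc k) \<cdot> g = w (K k) (K (Suc k)))" for k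
    using s(2)[of k] unfolding Q_def N_def K_def f_def by (auto split: prod.splits)
  then have mono: "strict_mono N" "strict_mono K"
    by (auto simp: strict_mono_Suc_iff)
  from Q obtain g where "\<And>k. g k \<in> Hom V (W (K k)) (U (N (Suc k)))"
      "\<And>k. g k \<cdot> f k = u (N k) (N (Suc k))" "\<And>k. f (Suc k) \<cdot> g k = w (K k) (K (Suc k))"
    by metis
  moreover have "omega_functor V U u" "omega_functor V W w"
    using U(1) W(1) by (auto simp: evolution_def)
  ultimately show ?thesis
    using zigzag_colimits_isomorphic[OF _ U(3) _ W(3) mono f] by blast
qed

section \<open>Existence of an absorbing evolution\<close>

text \<open>Replaces the countable sets of representatives by sequences, repetitions allowed, chosen
  simultaneously for all finite objects.\<close>

lemma locally_countable_enumeration: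
  assumes "locally_countable V T \<Theta>"
  shows "\<exists>F. \<forall>X. finite_object V T \<Theta> X \<longrightarrow> (\<forall>j::nat. F X j \<in> transitions_from V T X) \<and>
    (\<forall>f \<in> transitions_from V T X. \<exists>h j. is_iso V h \<and> Dom V h = Cod V f \<and> h \<cdot> f = F X j)"
proof -
  have ex: "\<exists>e. (\<forall>j::nat. e j \<in> transitions_from V T X) \<and>
      (\<forall>f \<in> transitions_from V T X. \<exists>h j. is_iso V h \<and> Dom V h = Cod V f \<and> h \<cdot> f = e j)"
    if X: "finite_object V T \<Theta> X" for X
  proof -
    have "\<exists>A \<subseteq> transitions_from V T X. countable A \<and>
        (\<forall>f \<in> transitions_from V T X. \<exists>h. is_iso V h \<and> Dom V h = Cod V f \<and> h \<cdot> f \<in> A)"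
      using assms X by (simp add: locally_countable_def)
    then obtain A where A: "A \<subseteq> transitions_from V T X" "countable A"
        "\<And>f. f \<in> transitions_from V T X \<Longrightarrow> \<exists>h. is_iso V h \<and> Dom V h = Cod V f \<and> h \<cdot> f \<in> A"
      by blast
    \<comment> \<open>The identity has a representative in \<open>A\<close>, so \<open>A\<close> is
      nonempty and \<open>from_nat_into\<close> enumerates exactly \<open>A\<close>.\<close>
    have "Ident V X \<in> transitions_from V T X"
      using Ident_in_transitions[OF finite_object_in_Obj[OF X]]
        Hom_Dom[OF Ident_in_Hom[OF finite_object_in_Obj[OF X]]]
      unfolding transitions_from_def by simp
    then have "A \<noteq> {}" using A(3) by blast
    then have "range (from_nat_into A) = A"
      using A(2) by (rule range_from_nat_into)
    then have e: "from_nat_into A j \<in> A" "a \<in> A \<Longrightarrow> \<exists>j. a = from_nat_into A j" for j a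
      by blast+
    show ?thesis
    proof (intro exI[of _ "from_nat_into A"] conjI allI ballI)
      show "from_nat_into A j \<in> transitions_from V T X" for j
        using e(1) A(1) by (rule subsetD[rotated])
      fix f assume "f \<in> transitions_from V T X"
      then obtain h where h: "is_iso V h" "Dom V h = Cod V f" "h \<cdot> f \<in> A"
        using A(3) by blast
      moreover obtain j where "h \<cdot> f = from_nat_into A j"
        using e(2)[OF h(3)] by (rule exE)
      ultimately show "\<exists>h j. is_iso V h \<and> Dom V h = Cod V f \<and> h \<cdot> f = from_nat_into A j"
        by (intro exI conjI)
    qed
  qed
  have "\<forall>X. \<exists>e. finite_object V T \<Theta> X \<longrightarrow> (\<forall>j::nat. e j \<in> transitions_from V T X) \<and>
      (\<forall>f \<in> transitions_from V T X. \<exists>h j. is_iso V h \<and> Dom V h = Cod V f \<and> h \<cdot> f = e j)"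
  proof
    fix X
    show "\<exists>e. finite_object V T \<Theta> X \<longrightarrow> (\<forall>j::nat. e j \<in> transitions_from V T X) \<and>
      (\<forall>f \<in> transitions_from V T X. \<exists>h j. is_iso V h \<and> Dom V h = Cod V f \<and> h \<cdot> f = e j)"
      using ex[of X] by (cases "finite_object V T \<Theta> X") simp_all
  qed
  then show ?thesis
    by (rule choice)
qed

text \<open>
  A state \<open>(X, r)\<close> at stage \<open>n\<close> records \<open>X = U\<^sub>n\<close> and \<open>r i = u\<^sub>i\<^sup>n\<close> for \<open>i \<le> n\<close>.  Stage \<open>n\<close>, read as a
  pair \<open>(i, j)\<close>, absorbs the \<open>j\<close>-th transition from \<open>U\<^sub>i\<close>; the coding of pairs satisfies \<open>i \<le> n\<close>.
\<close>

lemma absorbing_evolution_exists: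
  assumes LC: "locally_countable V T \<Theta>" and TA: "transition_amalgamation V T \<Theta>"
  shows "\<exists>U u. evolution V T \<Theta> U u \<and> absorption_property V T U u"
proof -
  obtain F where "\<forall>X. finite_object V T \<Theta> X \<longrightarrow> (\<forall>j::nat. F X j \<in> transitions_from V T X) \<and>
      (\<forall>f \<in> transitions_from V T X. \<exists>h j. is_iso V h \<and> Dom V h = Cod V f \<and> h \<cdot> f = F X j)"
    using locally_countable_enumeration[OF LC] by (rule exE)
  then have F: "finite_object V T \<Theta> X \<Longrightarrow> F X j \<in> transitions_from V T X"
    "\<lbrakk>finite_object V T \<Theta> X; f \<in> transitions_from V T X\<rbrakk> \<Longrightarrow>
       \<exists>h j. is_iso V h \<and> Dom V h = Cod V f \<and> h \<cdot> f = F X j" for X j f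
    by simp_all
  \<comment> \<open>Earlier objects are not stored; \<open>Dom V (r i)\<close> recovers the object
    of stage \<open>i\<close>. Its finiteness makes both the enumeration \<open>F\<close> and
    amalgamation available there.\<close>
  define P where "P n s \<longleftrightarrow> (case s of (X, r) \<Rightarrow> r n = Ident V X \<and> Dom V (r 0) = \<Theta> \<and>
      (\<forall>i \<le> n. r i \<in> paths V T \<and> Cod V (r i) = X \<and> finite_object V T \<Theta> (Dom V (r i))))"
    for n :: nat and s
  \<comment> \<open>The first clause extends the evolution by one transition; the second says that
    this extension absorbs the transition coded by \<open>n\<close>.\<close>
  define Q where "Q n s s' \<longleftrightarrow> (case s of (X, r) \<Rightarrow> case s' of (X', r') \<Rightarrow>
      (\<exists>t \<in> T. t \<in> Hom V X X' \<and> (\<forall>i \<le> n. r' i = t \<cdot> r i)) \<and>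
      (\<forall>i j. prod_decode n = (i, j) \<longrightarrow>
        (\<exists>p \<in> paths V T. p \<in> Hom V (Cod V (F (Dom V (r i)) j)) X' \<and> p \<cdot> F (Dom V (r i)) j = r' i)))"
    for n s s'
  have "\<exists>s. \<forall>n. P n (s n) \<and> Q n (s n) (s (Suc n))"
  proof (rule dependent_nat_choice)
    have "Ident V \<Theta> \<in> paths V T" "Ident V \<Theta> \<in> Hom V \<Theta> \<Theta>"
      using Ident_in_Hom[OF origin_in_Obj]
        paths.transition[OF Ident_in_transitions[OF origin_in_Obj]] by auto
    then have "P 0 (\<Theta>, \<lambda>i. Ident V \<Theta>)"
      unfolding P_def using finite_object_origin by (simp add: Hom_def)
    then show "\<exists>s. P 0 s" by blast
  next
    fix s :: "'o \<times> (nat \<Rightarrow> 'a)" and n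
    assume "P n s"
    then obtain X r where s: "s = (X, r)" and r: "r n = Ident V X" "Dom V (r 0) = \<Theta>"
      and r': "\<And>i. i \<le> n \<Longrightarrow> r i \<in> paths V T" "\<And>i. i \<le> n \<Longrightarrow> Cod V (r i) = X"
        "\<And>i. i \<le> n \<Longrightarrow> finite_object V T \<Theta> (Dom V (r i))"
      unfolding P_def by (cases s) auto
    have rH: "r i \<in> Hom V (Dom V (r i)) X" if "i \<le> n" for i
      using r' path_Hom that by metis
    obtain i j where ij: "prod_decode n = (i, j)" by fastforce
    then have i: "i \<le> n"
      using le_prod_encode_1[of i j] prod_decode_inverse[of n] by simp
    define f where "f = F (Dom V (r i)) j"
    have f: "f \<in> T" "f \<in> Hom V (Dom V (r i)) (Cod V f)"
      using F(1)[OF r'(3)[OF i], of j] transition_Hom[of f] unfolding f_def transitions_from_def by auto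
    \<comment> \<open>The scheduled transition \<open>f\<close> leaves an earlier object, so it is
      amalgamated with the path \<open>r i\<close> from there to \<open>X\<close>. The side
      \<open>t\<close> out of \<open>X\<close> becomes the next step, and \<open>p\<close> witnesses
      the absorption of \<open>f\<close>.\<close>
    obtain A t p where t: "t \<in> T" "t \<in> Hom V X A" and p: "p \<in> paths V T" "p \<in> Hom V (Cod V f) A"
      "t \<cdot> r i = p \<cdot> f"
      using amalgamate_path[OF TA r'(3)[OF i] f r'(1)[OF i] rH[OF i]] by blast
    \<comment> \<open>The identity is wanted at \<open>k = Suc n\<close>; larger \<open>k\<close>
      are outside the range of the invariant at that stage.\<close>
    define r1 where "r1 = (\<lambda>k. if k \<le> n then t \<cdot> r k else Ident V A)"
    have A: "A \<in> Obj V" using t Hom_Cod_in_Obj by blast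
    have tr: "t \<cdot> r k \<in> Hom V (Dom V (r k)) A" "t \<cdot> r k \<in> paths V T" if "k \<le> n" for k
      using Comp_in_Hom[OF rH[OF that] t(2)] r'(1,2)[OF that] paths.compose t Hom_Dom[OF t(2)] by metis+
    have "finite_object V T \<Theta> A"
      using finite_object_path[OF r'(3) tr(2,1)] by blast
    then have "P (Suc n) (A, r1)"
      unfolding P_def r1_def
      using tr r r' A Ident_in_Hom[OF A] Ident_in_transitions[OF A] paths.transition[of _ T V]
      by (auto simp: Hom_def)
    moreover have "Q n s (A, r1)"
      unfolding Q_def s using t p ij i by (auto simp: r1_def f_def[symmetric])
    ultimately show "\<exists>s'. P (Suc n) s' \<and> Q n s s'" by blast
  qed
  then obtain s where s: "\<And>n. P n (s n)" "\<And>n. Q n (s n) (s (Suc n))" by blast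
  define U where "U n = fst (s n)" for n
  define u where "u i n = snd (s n) i" for i n
  have P: "u n n = Ident V (U n)" "Dom V (u 0 n) = \<Theta>"
    "\<And>i. i \<le> n \<Longrightarrow> u i n \<in> paths V T" "\<And>i. i \<le> n \<Longrightarrow> Cod V (u i n) = U n"
    "\<And>i. i \<le> n \<Longrightarrow> finite_object V T \<Theta> (Dom V (u i n))" for n
    using s(1)[of n] unfolding P_def U_def u_def by (auto split: prod.splits)
  have Q: "\<exists>t \<in> T. t \<in> Hom V (U n) (U (Suc n)) \<and> (\<forall>i \<le> n. u i (Suc n) = t \<cdot> u i n)"
    "\<And>i j. prod_decode n = (i, j) \<Longrightarrow>
        \<exists>p \<in> paths V T. p \<in> Hom V (Cod V (F (Dom V (u i n)) j)) (U (Suc n)) \<and>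
          p \<cdot> F (Dom V (u i n)) j = u i (Suc n)" for n
    using s(2)[of n] unfolding Q_def U_def u_def by (auto split: prod.splits)
  have UO: "U n \<in> Obj V" for n
    using Q(1)[of n] Hom_Dom_in_Obj by blast
  have u_Suc: "u n (Suc n) \<in> T" "u n (Suc n) \<in> Hom V (U n) (U (Suc n))"
    "\<And>i. i \<le> n \<Longrightarrow> u i (Suc n) = u n (Suc n) \<cdot> u i n" for n
  proof -
    obtain t where t: "t \<in> T" "t \<in> Hom V (U n) (U (Suc n))" "\<forall>i \<le> n. u i (Suc n) = t \<cdot> u i n"
      using Q(1) by blast
    \<comment> \<open>The case \<open>i = n\<close> of the clause, where \<open>u n n\<close> is an
      identity.\<close>
    then have "u n (Suc n) = t"
      using P(1) Comp_Ident_right by simp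
    then show "u n (Suc n) \<in> T" "u n (Suc n) \<in> Hom V (U n) (U (Suc n))"
      "\<And>i. i \<le> n \<Longrightarrow> u i (Suc n) = u n (Suc n) \<cdot> u i n"
      using t by auto
  qed
  have uH: "u n m \<in> Hom V (U n) (U m)" if "n \<le> m" for n m
    using that
  proof (induction m rule: dec_induct)
    case base
    show ?case using P(1) Ident_in_Hom UO by simp
  next
    case (step m)
    then show ?case using u_Suc Comp_in_Hom by metis
  qed
  have uC: "u n k = u m k \<cdot> u n m" if "n \<le> m" "m \<le> k" for n m k
    using that(2)
  proof (induction k rule: dec_induct)
    case base
    show ?case using P(1) Comp_Ident_left[OF uH[OF that(1)]] by simp
  next
    case (step k)
    then show ?case
      using u_Suc(3)[of n k] u_Suc(3)[of m k] Comp_assoc[OF uH[OF that(1)] uH[of m k] u_Suc(2)[of k]] that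
      by simp
  qed
  have "U 0 = \<Theta>"
    using P(2)[of 0] Hom_Dom[OF uH[of 0 0]] by simp
  then have "evolution V T \<Theta> U u"
    unfolding evolution_def omega_functor_def using UO uH P(1) uC u_Suc by blast
  moreover have "absorption_property V T U u"
    unfolding absorption_property_def
  proof (intro allI ballI)
    fix n t assume t: "t \<in> transitions_from V T (U n)"
    then have tH: "t \<in> Hom V (U n) (Cod V t)"
      using transition_Hom[of t] by (auto simp: transitions_from_def)
    have "finite_object V T \<Theta> (U n)"
      using P(5)[of n n] Hom_Dom[OF uH[of n n]] by simp
    then obtain h j where h: "is_iso V h" "Dom V h = Cod V t" "h \<cdot> t = F (U n) j"
      using F(2) t by blast
    \<comment> \<open>The stage at which the listed copy \<open>h \<cdot> t\<close> of
      \<open>t\<close> is absorbed. As \<open>n \<le> k\<close>, the arrow \<open>u n k\<close>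
      starts at \<open>U n\<close>, so the clause for stage \<open>k\<close> does concern
      \<open>F (U n) j\<close>.\<close>
    define k where "k = prod_encode (n, j)"
    have "n \<le> k" unfolding k_def by (rule le_prod_encode_1)
    then have D: "Dom V (u n k) = U n" using uH Hom_Dom by blast
    obtain p where p: "p \<in> paths V T" "p \<in> Hom V (Cod V (F (U n) j)) (U (Suc k))"
        "p \<cdot> F (U n) j = u n (Suc k)"
      using Q(2)[of k n j] D unfolding k_def by auto
    \<comment> \<open>Isomorphisms are transitions, so \<open>p \<cdot> h\<close> is still a path
      and absorbs \<open>t\<close> itself rather than its copy.\<close>
    have hT: "h \<in> T" and hH: "h \<in> Hom V (Cod V t) (Cod V h)"
      using iso_transition transition_Hom h by metis+
    have "Cod V (F (U n) j) = Cod V h"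
      using Comp_in_Hom[OF tH hH] h Hom_Cod by metis
    then have pH: "p \<in> Hom V (Cod V h) (U (Suc k))" using p by simp
    have "p \<cdot> h \<cdot> t = u n (Suc k)"
      using Comp_assoc[OF tH hH pH] h p by simp
    moreover have "p \<cdot> h \<in> paths V T" "p \<cdot> h \<in> Hom V (Cod V t) (U (Suc k))"
      using path_Comp[OF p(1) paths.transition[OF hT] hH pH] Comp_in_Hom[OF hH pH] by auto
    ultimately show "\<exists>m \<ge> n. \<exists>g \<in> paths V T. g \<in> Hom V (Cod V t) (U m) \<and> g \<cdot> t = u n m"
      using \<open>n \<le> k\<close> le_SucI by blast
  qed
  ultimately show ?thesis by blast
qed

end

theorem theorem4p7:
  fixes V :: "('o, 'a) cat_struct" and T :: "'a set" and \<Theta> :: 'o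
  assumes "evolution_system V T \<Theta>"
    and "locally_countable V T \<Theta>"
    and "transition_amalgamation V T \<Theta>"
  shows "(\<exists>U u. evolution V T \<Theta> U u \<and> absorption_property V T U u) \<and>
    (\<forall>U u W w.
       evolution V T \<Theta> U u \<and> absorption_property V T U u \<and>
       evolution V T \<Theta> W w \<and> absorption_property V T W w \<longrightarrow>
       (\<forall>L c M d. is_colimit V U u L c \<and> is_colimit V W w M d \<longrightarrow>
          isomorphic_objects V L M))"
proof -
  interpret evolution_system V T \<Theta> by fact
  show ?thesis
    using absorbing_evolution_exists absorbing_colimits_isomorphic assms(2,3) by blast
qed

end
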